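(* The following algorithm computes $(1.7,1+\varepsilon)$-approximate packings. Given an instance $I$ with colours $c_1,\dots,m$ ordered arbitrarily as $c_1,\dots,c_m$: for each colour $c_i$, pack the items of $I_{c_i}$ into new (monochromatic) bins using the asymptotic approximation scheme of Fernandez de la Vega and Lueker with parameter $\varepsilon$, obtaining a packing $P(c_i)$; let $P=P(c_1)\cup\dots\cup P(c_m)$; then, starting from an empty packing $P'$, pack every item into $P'$ using Bounded Best-Fit with $k=2$ open bins, presenting the items in the order in which they appear in $P$ (bin by bin, the bins of $P(c_1)$ first, then those of $P(c_2)$, etc.); return $P'$.
   Context: Coloured bin packing: an instance $I$ is a finite set of items, each item $e$ having a size $s(e)\in(0,1]$ and a colour $c(e)\in\{1,\dots,m\}$; items are packed into unit-capacity bins. $I_c$ is the set of items of colour $c$; $\mathrm{OPT}(I)$, $\mathrm{OPT}(I_c)$ are the minimum numbers of bins needed to pack $I$, $I_c$. For a packing $P$, $P(I)$ is the number of bins and $P_c(I)$ the number of bins containing an item of colour $c$. A packing is $(\alpha,\beta)$-approximate if $P(I)\le\alpha\,\mathrm{OPT}(I)+O(1)$ and $P_c(I)\le\beta\,\mathrm{OPT}(I_c)+O(1)$ for all $c$, with additive constants independent of the instance. The Fernandez de la Vega–Lueker scheme with parameter $\varepsilon$ packs any list $L$ of items into at most $(1+2\varepsilon)\mathrm{OPT}(L)+1$ bins in polynomial time (for fixed $\varepsilon$). Bounded Best-Fit with parameter $k$: at most $k$ bins are open at any time, closed bins are never reopened; an item is packed into the fullest open bin with room for it; if none has room, the fullest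 open bin is closed and a new empty bin opened. With $k=2$ it uses at most $1.7\,\mathrm{OPT}+O(1)$ bins on any item sequence.
   Formalization: With the scheme's guarantee (1+2ε)OPT+1, parameter ε does not yield colour ratio 1+ε; the formal theorem states (1.7, 1+2ε) for parameter ε and (1.7, 1+ε) when the scheme is run with parameter ε/2. *)

theory Defs
  imports Complex_Main "HOL-Library.Disjoint_Sets"
begin

text \<open>The identifier only serves to distinguish items of equal size and colour.\<close>

record item =
  ident :: nat
  isize :: real
  colour :: nat

definition items :: "item set \<Rightarrow> bool" where
  "items L \<longleftrightarrow> finite L \<and> (\<forall>e\<in>L. 0 < isize e \<and> isize e \<le> 1)"

definition coloured_instance :: "nat \<Rightarrow> item set \<Rightarrow> bool" where
  "coloured_instance m I \<longleftrightarrow> items I \<and> (\<forall>e\<in>I. colour e \<in> {1..m})"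

definition of_colour :: "item set \<Rightarrow> nat \<Rightarrow> item set" where
  "of_colour I c = {e \<in> I. colour e = c}"

definition level :: "item set \<Rightarrow> real" where
  "level B = (\<Sum>e\<in>B. isize e)"

text \<open>A packing is the set of its nonempty bins; its number of bins is its cardinality.\<close>

definition is_packing :: "item set \<Rightarrow> item set set \<Rightarrow> bool" where
  "is_packing L P \<longleftrightarrow> partition_on L P \<and> (\<forall>B\<in>P. level B \<le> 1)"

definition OPT :: "item set \<Rightarrow> nat" where
  "OPT L = (LEAST n. \<exists>P. is_packing L P \<and> card P = n)"

definition bins_with_colour :: "item set set \<Rightarrow> nat \<Rightarrow> nat" where
  "bins_with_colour P c = card {B \<in> P. \<exists>e\<in>B. colour e = c}"

text \<open>
  An algorithm maps the number \<open>m\<close> of colours and the item set to the set of all packings it may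
  return, over all resolutions of its arbitrary choices.
\<close>

definition computes_approximate_packings ::
    "real \<Rightarrow> real \<Rightarrow> (nat \<Rightarrow> item set \<Rightarrow> item set set set) \<Rightarrow> bool" where
  "computes_approximate_packings \<alpha> \<beta> alg \<longleftrightarrow>
     (\<exists>K::real. \<forall>m I. coloured_instance m I \<longrightarrow>
        alg m I \<noteq> {} \<and>
        (\<forall>P\<in>alg m I. is_packing I P \<and>
           real (card P) \<le> \<alpha> * real (OPT I) + K \<and>
           (\<forall>c\<in>{1..m}. real (bins_with_colour P c) \<le> \<beta> * real (OPT (of_colour I c)) + K)))"

text \<open>Packings whose bins, and the items within each bin, come in a definite order.\<close>

definition is_ordered_packing :: "item set \<Rightarrow> item list list \<Rightarrow> bool" where
  "is_ordered_packing L bs \<longleftrightarrow>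
     distinct (concat bs) \<and> [] \<notin> set bs \<and> is_packing L (set ` set bs)"

text \<open>
  The scheme of Fernandez de la Vega and Lueker enters only through its performance guarantee.
\<close>

definition flvl_guarantee :: "real \<Rightarrow> (item set \<Rightarrow> item list list) \<Rightarrow> bool" where
  "flvl_guarantee \<epsilon> A \<longleftrightarrow>
     (\<forall>L. items L \<longrightarrow>
        is_ordered_packing L (A L) \<and> real (length (A L)) \<le> (1 + 2 * \<epsilon>) * real (OPT L) + 1)"

definition fits :: "item \<Rightarrow> item set \<Rightarrow> bool" where
  "fits e B \<longleftrightarrow> level B + isize e \<le> 1"

text \<open>
  \<open>bounded_best_fit k es C Q\<close>: after the items \<open>es\<close>, presented in this order, \<open>C\<close> may be the set of
  closed bins and \<open>Q\<close> the set of open bins. Ties between equally full bins are broken arbitrarily.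
  Bins are opened on demand, so a bin is closed only if already \<open>k\<close> bins are open.
\<close>

inductive bounded_best_fit ::
    "nat \<Rightarrow> item list \<Rightarrow> item set set \<Rightarrow> item set set \<Rightarrow> bool" for k :: nat where
  start: "bounded_best_fit k [] {} {}"
| pack: "bounded_best_fit k (es @ [e]) C (insert (insert e B) (Q - {B}))"
    if "bounded_best_fit k es C Q" "B \<in> Q" "fits e B"
       "\<forall>B'\<in>Q. fits e B' \<longrightarrow> level B' \<le> level B"
| open_new: "bounded_best_fit k (es @ [e]) C (insert {e} Q)"
    if "bounded_best_fit k es C Q" "\<forall>B\<in>Q. \<not> fits e B" "card Q < k"
| close_and_open: "bounded_best_fit k (es @ [e]) (insert B C) (insert {e} (Q - {B}))"
    if "bounded_best_fit k es C Q" "\<forall>B'\<in>Q. \<not> fits e B'" "card Q = k"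
       "B \<in> Q" "\<forall>B'\<in>Q. level B' \<le> level B"

text \<open>The list \<open>cs\<close> is the arbitrary order of the colours.\<close>

definition colour_then_bbf ::
    "(item set \<Rightarrow> item list list) \<Rightarrow> nat \<Rightarrow> item set \<Rightarrow> item set set set" where
  "colour_then_bbf A m I =
     {C \<union> Q | C Q cs. distinct cs \<and> set cs = {1..m} \<and>
        bounded_best_fit 2 (concat (concat (map (\<lambda>c. A (of_colour I c)) cs))) C Q}"

end

theory Submission
  imports Defs
begin

text \<open>
  The bound 1.7 comes from the First-Fit weighting \<open>6/5 * s + bonus s\<close>: every bin of an optimal
  packing has weight at most 1.7, so it suffices that Bounded Best-Fit with two open bins uses at
  most one bin per unit of weight, up to a constant. The open bins always have total level above 1,
  so a closed bin, being the fuller one, has level above 1/2. The bonus of the item \<open>e\<close> that opens a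
  bin is spent as follows. If \<open>e > 1/2\<close>, the bonus 0.4 pays for the bin closed by \<open>e\<close>. Otherwise the
  bonus of \<open>e\<close> is saved until a second item \<open>h\<close> joins \<open>e\<close>; a bin closed before that is closed by an
  item above \<open>1/2\<close>, which pays for it, as only such items do not fit with \<open>e\<close>. As the other open
  bin is fuller, neither \<open>e\<close> nor \<open>h\<close> fits into it, and the next closed bin has level
  \<open>x \<ge> max (1 - min e h) (e + h)\<close>, whence \<open>6/5 * x + bonus e + bonus h \<ge> 1\<close>.

  For the colours, while the items of one bin of the monochromatic packing arrive, at most one bin
  is opened, since all later items of that bin fit into the bin opened last.
\<close>

section \<open>Weights\<close>

text \<open>Continuous up to 1/2, where it jumps from 1/10 to 2/5. The jump lifts the weight
  \<open>6/5 * x + bonus x\<close> of any item above 1/2 beyond 1.\<close>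

definition bonus :: "real \<Rightarrow> real" where
  "bonus x = (if x \<le> 1/6 then 0 else if x \<le> 1/3 then 3/5 * (x - 1/6)
              else if x \<le> 1/2 then 1/10 else 2/5)"

lemma bonus_nonneg: "0 \<le> bonus x"
  by (auto simp: bonus_def)

lemma bonus_le: "x \<le> 1/2 \<Longrightarrow> bonus x \<le> 1/10"
  by (auto simp: bonus_def)

text \<open>The middle linear piece, extended to the right, dominates the flat piece because both
  equal 1/10 at 1/3.\<close>

lemma bonus_le_linear: "1/6 < x \<Longrightarrow> x \<le> 1/2 \<Longrightarrow> bonus x \<le> 3/5 * x - 1/10"
  by (auto simp: bonus_def)

lemma bonus_big: "1/2 < x \<Longrightarrow> bonus x = 2/5"
  by (auto simp: bonus_def)

text \<open>If \<open>h > 1/2\<close>, its bonus 2/5 and \<open>x \<ge> 1 - e \<ge> 1/2\<close>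
  suffice. Otherwise let \<open>m\<close> be the smaller of \<open>e\<close> and \<open>h\<close>.
  For \<open>m \<le> 1/6\<close>, \<open>x \<ge> 5/6\<close> is enough. For \<open>m\<close> up to
  1/3, the two bonuses are at least \<open>6/5 * m - 1/5\<close>, which offsets the loss in
  \<open>x \<ge> 1 - m\<close>. Beyond 1/3, \<open>x \<ge> e + h > 2/3\<close> and both bonuses are
  1/10.\<close>

lemma bonus_pair_pays:
  assumes "x \<ge> 1 - e" "x \<ge> 1 - h" "x \<ge> e + h" "e \<le> 1/2"
  shows "1 \<le> 6/5 * x + bonus e + bonus h"
  using assms unfolding bonus_def by (auto simp: field_simps)

section \<open>Levels of bins\<close>

lemma level_mono:
  assumes "items B" "A \<subseteq> B"
  shows "level A \<le> level B"
  using assms unfolding level_def items_def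
  by (intro sum_mono2) (auto intro: less_imp_le)

lemma items_subset: "items B \<Longrightarrow> A \<subseteq> B \<Longrightarrow> items A"
  unfolding items_def by (auto intro: finite_subset)

lemma level_insert: "finite B \<Longrightarrow> e \<notin> B \<Longrightarrow> level (insert e B) = isize e + level B"
  by (simp add: level_def)

lemma level_singleton [simp]: "level {e} = isize e"
  by (simp add: level_def)

lemma card_bounded_by_level:
  assumes "finite M" "\<And>e. e \<in> M \<Longrightarrow> s \<le> isize e"
  shows "s * real (card M) \<le> level M"
  using sum_mono[of M "\<lambda>_. s" isize] assms by (simp add: level_def mult.commute)

text \<open>Only items above 1/6 earn a bonus. If none exceeds 1/2, there are at most five of them,
  worth at most 1/10 each. If one exceeds 1/2, it earns 2/5, and the others fill less than 1/2 and
  earn at most 1/10 together.\<close>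

lemma sum_bonus_le:
  assumes "items B" "level B \<le> 1"
  shows "(\<Sum>e\<in>B. bonus (isize e)) \<le> 1/2"
proof -
  define M where "M = {e \<in> B. 1/6 < isize e}"
  have B: "finite B" and M: "finite M" "M \<subseteq> B"
    using assms by (auto simp: M_def items_def)
  have sumM: "(\<Sum>e\<in>B. bonus (isize e)) = (\<Sum>e\<in>M. bonus (isize e))"
    using B by (intro sum.mono_neutral_right) (auto simp: M_def bonus_def)
  have levM: "level M \<le> 1"
    using level_mono[OF assms(1) M(2)] assms(2) by simp
  show ?thesis
  proof (cases "\<exists>b\<in>M. 1/2 < isize b")
    case False
    \<comment> \<open>Strictness matters: six items above 1/6 would overflow the bin.\<close>
    have "1/6 * real (card M) < level M" if "M \<noteq> {}"
      using sum_strict_mono[of M "\<lambda>_. 1/6" isize] M that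
      by (simp add: level_def mult.commute M_def)
    then have "card M < 6"
      using levM by (cases "M = {}") auto
    moreover have "(\<Sum>e\<in>M. bonus (isize e)) \<le> (\<Sum>e\<in>M. 1/10)"
      using False by (intro sum_mono bonus_le) force
    ultimately show ?thesis
      by (simp add: sumM)
  next
    case True
    then obtain b where b: "b \<in> M" "1/2 < isize b" by blast
    define R where "R = M - {b}"
    have R: "finite R" "b \<notin> R" "M = insert b R"
      using M b by (auto simp: R_def)
    have levR: "level R < 1/2"
      using levM b level_insert[OF R(1,2)] R(3) by simp
    have itR: "items R"
      using items_subset[OF assms(1)] M R by auto
    have small: "isize e \<le> 1/2" "1/6 < isize e" if "e \<in> R" for e
    proof -
      show "isize e \<le> 1/2"
        using level_mono[OF itR, of "{e}"] levR that by simp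
      show "1/6 < isize e"
        using that by (auto simp: R_def M_def)
    qed
    have "1/6 * real (card R) \<le> level R"
      by (rule card_bounded_by_level[OF R(1)]) (use small in force)
    with levR have "card R < 3" by linarith
    then have "card R \<le> 1 \<or> card R = 2" by linarith
    moreover have "(\<Sum>e\<in>R. bonus (isize e)) \<le> 1/10 * card R"
      using sum_mono[of R "\<lambda>e. bonus (isize e)" "\<lambda>_. 1/10"] small bonus_le by simp
    \<comment> \<open>This bound handles two remaining items:
      \<open>3/5 * 1/2 - 2/10 = 1/10\<close>. The previous one handles at most one.\<close>
    moreover have "(\<Sum>e\<in>R. bonus (isize e)) \<le> (\<Sum>e\<in>R. 3/5 * isize e - 1/10)"
      using small by (intro sum_mono bonus_le_linear)
    hence "(\<Sum>e\<in>R. bonus (isize e)) \<le> 3/5 * level R - 1/10 * card R"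
      by (simp add: sum_subtractf level_def sum_distrib_left)
    ultimately have "(\<Sum>e\<in>R. bonus (isize e)) \<le> 1/10"
      using levR by (elim disjE) auto
    then show ?thesis
      using R b by (simp add: sumM bonus_big)
  qed
qed

text \<open>Singleton bins form a packing since no item exceeds 1, so the \<open>LEAST\<close> in
  \<open>OPT\<close> ranges over a nonempty set.\<close>

lemma OPT_attained:
  assumes "items L"
  obtains P where "is_packing L P" "card P = OPT L"
proof -
  have "is_packing L ((\<lambda>e. {e}) ` L)"
    using assms by (auto simp: is_packing_def partition_on_def disjoint_def items_def)
  hence "\<exists>n P. is_packing L P \<and> card P = n" by blast
  from LeastI_ex[OF this] show ?thesis
    using that unfolding OPT_def by blast
qed

lemma sum_partition_on:
  assumes "finite L" "partition_on L P"
  shows "(\<Sum>e\<in>L. f e) = (\<Sum>B\<in>P. \<Sum>e\<in>B. f e)"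
proof -
  have "\<Union>P = L" "\<forall>B\<in>P. finite B" "disjoint P"
    using assms finite_subset[of _ L] by (auto simp: partition_on_def)
  then show ?thesis
    using sum.Union_disjoint[of P f] by (auto simp: disjoint_def)
qed

lemma total_weight_le_OPT:
  assumes "items L"
  shows "6/5 * level L + (\<Sum>e\<in>L. bonus (isize e)) \<le> 1.7 * real (OPT L)"
proof -
  obtain P where P: "is_packing L P" "card P = OPT L"
    using OPT_attained[OF assms] .
  have L: "finite L" using assms by (simp add: items_def)
  have part: "partition_on L P" using P by (simp add: is_packing_def)
  \<comment> \<open>The constant is \<open>6/5 * 1 + 1/2\<close>: full level plus maximal
    bonus.\<close>
  have bin: "(\<Sum>e\<in>B. 6/5 * isize e + bonus (isize e)) \<le> 1.7" if "B \<in> P" for B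
  proof -
    have "B \<subseteq> L" "level B \<le> 1"
      using P that by (auto simp: is_packing_def partition_on_def)
    then have "6/5 * level B + (\<Sum>e\<in>B. bonus (isize e)) \<le> 1.7"
      using sum_bonus_le[of B] items_subset[OF assms, of B] by simp
    then show ?thesis
      by (simp add: sum.distrib level_def sum_distrib_left)
  qed
  have "6/5 * level L + (\<Sum>e\<in>L. bonus (isize e)) = (\<Sum>e\<in>L. 6/5 * isize e + bonus (isize e))"
    by (simp add: sum.distrib level_def sum_distrib_left)
  also have "\<dots> = (\<Sum>B\<in>P. \<Sum>e\<in>B. 6/5 * isize e + bonus (isize e))"
    by (rule sum_partition_on[OF L part])
  also have "\<dots> \<le> (\<Sum>B\<in>P. 1.7)"
    by (rule sum_mono[OF bin])
  finally show ?thesis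
    using P by (simp add: mult.commute)
qed

section \<open>Runs of Bounded Best-Fit\<close>

inductive bbf_step ::
    "nat \<Rightarrow> item \<Rightarrow> item set set \<Rightarrow> item set set \<Rightarrow> item set set \<Rightarrow> item set set \<Rightarrow> bool"
    for k e C Q where
  pack: "bbf_step k e C Q C (insert (insert e B) (Q - {B}))"
    if "B \<in> Q" "fits e B" "\<forall>B'\<in>Q. fits e B' \<longrightarrow> level B' \<le> level B"
| open_new: "bbf_step k e C Q C (insert {e} Q)"
    if "\<forall>B\<in>Q. \<not> fits e B" "card Q < k"
| close_and_open: "bbf_step k e C Q (insert B C) (insert {e} (Q - {B}))"
    if "\<forall>B'\<in>Q. \<not> fits e B'" "card Q = k" "B \<in> Q" "\<forall>B'\<in>Q. level B' \<le> level B"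

text \<open>The starting state is a parameter so that a run can be cut between colours and between
  monochromatic bins.\<close>

inductive bbf_run ::
    "nat \<Rightarrow> item set set \<Rightarrow> item set set \<Rightarrow> item list \<Rightarrow> item set set \<Rightarrow> item set set \<Rightarrow> bool"
    for k C0 Q0 where
  Nil: "bbf_run k C0 Q0 [] C0 Q0"
| snoc: "bbf_run k C0 Q0 es C Q \<Longrightarrow> bbf_step k e C Q C' Q' \<Longrightarrow> bbf_run k C0 Q0 (es @ [e]) C' Q'"

lemma bbf_run_Nil_iff [simp]: "bbf_run k C0 Q0 [] C Q \<longleftrightarrow> C = C0 \<and> Q = Q0"
  by (auto elim: bbf_run.cases intro: bbf_run.Nil)

lemma bbf_run_snoc_iff:
  "bbf_run k C0 Q0 (es @ [e]) C' Q' \<longleftrightarrow>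
     (\<exists>C Q. bbf_run k C0 Q0 es C Q \<and> bbf_step k e C Q C' Q')"
  by (subst bbf_run.simps) blast

lemma bbf_run_append:
  "bbf_run k C0 Q0 (es @ fs) C Q \<longleftrightarrow>
     (\<exists>C1 Q1. bbf_run k C0 Q0 es C1 Q1 \<and> bbf_run k C1 Q1 fs C Q)"
proof (induction fs arbitrary: C Q rule: rev_induct)
  case (snoc f fs)
  show ?case
    unfolding append_assoc[symmetric] bbf_run_snoc_iff snoc by blast
qed simp

lemma bounded_best_fit_iff_run: "bounded_best_fit k es C Q \<longleftrightarrow> bbf_run k {} {} es C Q"
proof
  show "bounded_best_fit k es C Q \<Longrightarrow> bbf_run k {} {} es C Q"
    by (induction rule: bounded_best_fit.induct)
       (auto intro: bbf_run.intros bbf_step.intros)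
  show "bbf_run k {} {} es C Q \<Longrightarrow> bounded_best_fit k es C Q"
    by (induction rule: bbf_run.induct)
       (auto elim!: bbf_step.cases intro: bounded_best_fit.intros)
qed

text \<open>Bins are identified with their item sets. Disjointness of \<open>C\<close> and
  \<open>Q\<close> guarantees that closing a bin adds a new element to \<open>C\<close>.\<close>

definition bbf_state :: "nat \<Rightarrow> item set \<Rightarrow> item set set \<Rightarrow> item set set \<Rightarrow> bool" where
  "bbf_state k A C Q \<longleftrightarrow> is_packing A (C \<union> Q) \<and> C \<inter> Q = {} \<and> card Q \<le> k"

lemma bbf_state_finite:
  assumes "bbf_state k A C Q" "items A"
  shows "finite C" "finite Q" "B \<in> C \<union> Q \<Longrightarrow> finite B"
proof -
  have *: "partition_on A (C \<union> Q)" "finite A"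
    using assms by (auto simp: bbf_state_def is_packing_def items_def)
  have "finite (C \<union> Q)"
    by (rule finite_elements[OF *(2,1)])
  then show "finite C" "finite Q" by auto
  show "B \<in> C \<union> Q \<Longrightarrow> finite B"
    using * by (auto simp: partition_on_def intro: finite_subset)
qed

lemma bbf_state_fresh:
  assumes "bbf_state k A C Q" "e \<notin> A" "B \<in> C \<union> Q"
  shows "e \<notin> B" "B \<noteq> {}"
  using assms by (auto simp: bbf_state_def is_packing_def partition_on_def)

lemma card_replace_le:
  assumes "finite Q" "B \<in> Q"
  shows "card (insert D (Q - {B})) \<le> card Q"
proof -
  have "card (insert D (Q - {B})) \<le> Suc (card (Q - {B}))"
    using assms(1) by (simp add: card_insert_if)
  then show ?thesis using card.remove[OF assms] by linarith
qed

text \<open>As \<open>e\<close> is fresh, the bin receiving it coincides with no old bin, so bins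
  never merge as elements of a set.\<close>

lemma bbf_step_state:
  assumes step: "bbf_step k e C Q C' Q'" and st: "bbf_state k A C Q"
    and it: "items (insert e A)" and e: "e \<notin> A"
  shows "bbf_state k (insert e A) C' Q'"
proof -
  have itA: "items A" using items_subset[OF it] by blast
  note fin = bbf_state_finite[OF st itA]
  note fresh = bbf_state_fresh[OF st e]
  have part: "\<Union>(C \<union> Q) = A" "disjoint (C \<union> Q)" "{} \<notin> C \<union> Q" "C \<inter> Q = {}" "card Q \<le> k"
    and lev: "\<And>B. B \<in> C \<union> Q \<Longrightarrow> level B \<le> 1"
    using st by (auto simp: bbf_state_def is_packing_def partition_on_def)
  have e1: "isize e \<le> 1" using it by (simp add: items_def)
  have new: "disjoint (insert D S)" if "disjoint S" "\<And>B. B \<in> S \<Longrightarrow> D \<inter> B = {}" for D and S :: "item set set"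
    using that by (auto simp: disjoint_def)
  show ?thesis
    using step
  proof cases
    case (pack B)
    have dis: "B \<inter> B' = {}" if "B' \<in> C \<union> Q" "B' \<noteq> B" for B'
      using part(2) pack that by (auto simp: disjoint_def)
    have BC: "B \<notin> C" using pack part by blast
    have "disjoint (insert (insert e B) (C \<union> (Q - {B})))"
    proof (rule new)
      show "disjoint (C \<union> (Q - {B}))"
        using part(2) by (auto simp: disjoint_def)
      show "insert e B \<inter> B' = {}" if "B' \<in> C \<union> (Q - {B})" for B'
        using dis[of B'] fresh(1)[of B'] that BC by auto
    qed
    moreover have "level (insert e B) \<le> 1"
      using pack fresh fin by (simp add: level_insert fits_def)
    moreover have "card (insert (insert e B) (Q - {B})) \<le> k"
      using card_replace_le[OF fin(2) pack(3), of "insert e B"] part(5) by linarith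
    moreover have "\<Union>(C \<union> Q') = insert e A"
      using pack part(1) by auto
    moreover have "insert e B \<notin> C"
      using fresh(1)[of "insert e B"] by auto
    ultimately show ?thesis
      using pack part lev
      by (auto simp: bbf_state_def is_packing_def partition_on_def)
  next
    case open_new
    have "disjoint (insert {e} (C \<union> Q))"
      using fresh part by (intro new) auto
    moreover have "{e} \<notin> C" using fresh(1)[of "{e}"] by auto
    moreover have "card (insert {e} Q) \<le> k"
      using open_new fin by (simp add: card_insert_if)
    ultimately show ?thesis
      using open_new part lev e1
      by (auto simp: bbf_state_def is_packing_def partition_on_def)
  next
    case (close_and_open B)
    have eq: "insert B C \<union> (insert {e} (Q - {B})) = insert {e} (C \<union> Q)"
      using close_and_open by auto
    have "disjoint (insert {e} (C \<union> Q))"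
      using fresh part by (intro new) auto
    moreover have "{e} \<notin> C" "{e} \<noteq> B" using fresh(1)[of "{e}"] close_and_open by auto
    moreover have "card (insert {e} (Q - {B})) \<le> k"
      using card_replace_le[OF fin(2) close_and_open(5), of "{e}"] part(5) by linarith
    ultimately show ?thesis
      using close_and_open part lev e1 
      unfolding bbf_state_def is_packing_def partition_on_def close_and_open(1,2) eq
      by auto
  qed
qed

lemma bbf_run_state:
  assumes "bbf_run k {} {} es C Q" "items (set es)" "distinct es"
  shows "bbf_state k (set es) C Q"
  using assms
proof (induction rule: bbf_run.induct)
  case Nil
  then show ?case by (simp add: bbf_state_def is_packing_def partition_on_def)
next
  case (snoc es C Q e C' Q')
  have "items (set es)" using items_subset[OF snoc.prems(1)] by auto
  then show ?case
    using bbf_step_state[OF snoc.hyps(2) snoc.IH] snoc.prems by simp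
qed

text \<open>The three rules are exhaustive when at most \<open>k\<close> bins are open, and
  \<open>0 < k\<close> provides a bin to close.\<close>

lemma bbf_step_exists:
  assumes "finite Q" "card Q \<le> k" "0 < k"
  obtains C' Q' where "bbf_step k e C Q C' Q'"
proof -
  have max: "\<exists>B\<in>S. \<forall>B'\<in>S. level B' \<le> level B" if "S \<subseteq> Q" "S \<noteq> {}" for S
  proof -
    have "finite S" using that assms finite_subset by blast
    with that(2) have "Max (level ` S) \<in> level ` S" "\<forall>B'\<in>S. level B' \<le> Max (level ` S)"
      by auto
    then show ?thesis by (metis imageE)
  qed
  consider "{B \<in> Q. fits e B} \<noteq> {}" | "\<forall>B\<in>Q. \<not> fits e B" "card Q < k"
    | "\<forall>B\<in>Q. \<not> fits e B" "card Q = k" "Q \<noteq> {}"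
    using assms by force
  then show ?thesis
  proof cases
    case 1
    then show ?thesis using max[OF _ 1] that bbf_step.pack[of _ Q e k C] by fastforce
  next
    case 2
    then show ?thesis using that bbf_step.open_new by blast
  next
    case 3
    then show ?thesis using max[of Q] that bbf_step.close_and_open[of Q e k] by blast
  qed
qed

lemma bbf_run_exists:
  assumes "0 < k" "items (set es)" "distinct es"
  shows "\<exists>C Q. bbf_run k {} {} es C Q"
  using assms(2,3)
proof (induction es rule: rev_induct)
  case Nil
  then show ?case by auto
next
  case (snoc e es)
  have it: "items (set es)" using items_subset[OF snoc.prems(1)] by auto
  then obtain C Q where run: "bbf_run k {} {} es C Q"
    using snoc by auto
  have st: "bbf_state k (set es) C Q"
    using bbf_run_state[OF run it] snoc.prems by simp
  obtain C' Q' where "bbf_step k e C Q C' Q'"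
    using bbf_step_exists[OF bbf_state_finite(2)[OF st it] _ assms(1), of e C] st
    unfolding bbf_state_def by blast
  then show ?case using run bbf_run.snoc by blast
qed

section \<open>The total number of bins\<close>

text \<open>A potential: bonuses are credited when items arrive, levels only when their bin is
  closed. The levels of open bins thus remain available to pay for closing them.\<close>

definition surplus :: "item set \<Rightarrow> item set set \<Rightarrow> real" where
  "surplus A C = 6/5 * (\<Sum>B\<in>C. level B) + (\<Sum>e\<in>A. bonus (isize e)) - real (card C)"

lemma surplus_insert_item:
  "finite A \<Longrightarrow> e \<notin> A \<Longrightarrow> surplus (insert e A) C = surplus A C + bonus (isize e)"
  by (simp add: surplus_def)

lemma surplus_insert_bin:
  "finite C \<Longrightarrow> B \<notin> C \<Longrightarrow> surplus A (insert B C) = surplus A C + 6/5 * level B - 1"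
  by (simp add: surplus_def algebra_simps)

text \<open>
  The last alternative is the phase in which the bonus of \<open>f\<close> is saved; in the preceding one the
  next bin to be closed is already paid for.
\<close>

definition bbf2_inv :: "item set \<Rightarrow> item set set \<Rightarrow> item set set \<Rightarrow> bool" where
  "bbf2_inv A C Q \<longleftrightarrow>
     C = {} \<and> (Q = {} \<or> (\<exists>X. Q = {X})) \<or>
     (\<exists>X Y. Q = {X, Y} \<and> X \<noteq> Y \<and> level X \<le> level Y \<and> 1 < level X + level Y \<and>
        (0 \<le> surplus A C + 6/5 * level Y \<or>
         (\<exists>f. X = {f} \<and> isize f \<le> 1/2 \<and> bonus (isize f) - 1 \<le> surplus A C)))"

text \<open>If either bin can be paid for, so can the fuller one. This spares the case analysis from
  tracking which bin is fuller.\<close>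

lemma bbf2_inv_paid:
  assumes "Q = {X, Y}" "X \<noteq> Y" "1 < level X + level Y"
    and "0 \<le> surplus A C + 6/5 * level X \<or> 0 \<le> surplus A C + 6/5 * level Y"
  shows "bbf2_inv A C Q"
proof (cases "level X \<le> level Y")
  case True
  then have "0 \<le> surplus A C + 6/5 * level Y" using assms by linarith
  then show ?thesis
    using assms True unfolding bbf2_inv_def by blast
next
  case False
  then have "Q = {Y, X}" "Y \<noteq> X" "level Y \<le> level X" "1 < level Y + level X"
      "0 \<le> surplus A C + 6/5 * level X"
    using assms by (auto simp: insert_commute)
  then show ?thesis
    unfolding bbf2_inv_def by blast
qed

text \<open>The order of the levels is automatic: \<open>f\<close> is at most 1/2 and the total
  exceeds 1, so \<open>Y\<close> is above 1/2.\<close>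

lemma bbf2_inv_saving:
  assumes "Q = {{f}, Y}" "{f} \<noteq> Y" "1 < isize f + level Y" "isize f \<le> 1/2"
    and "bonus (isize f) - 1 \<le> surplus A C"
  shows "bbf2_inv A C Q"
proof -
  have "level {f} \<le> level Y" "1 < level {f} + level Y"
    using assms by auto
  with assms show ?thesis
    unfolding bbf2_inv_def by blast
qed

lemma bbf_step_inv:
  assumes step: "bbf_step 2 e C Q C' Q'" and st: "bbf_state 2 A C Q"
    and it: "items (insert e A)" and e: "e \<notin> A" and inv: "bbf2_inv A C Q"
  shows "bbf2_inv (insert e A) C' Q'"
proof -
  have itA: "items A" using items_subset[OF it] by blast
  note fin = bbf_state_finite[OF st itA]
  note fresh = bbf_state_fresh[OF st e]
  have epos: "0 < isize e" using it by (simp add: items_def)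
  have lev_ins: "level (insert e B) = isize e + level B" if "B \<in> Q" for B
    using fin fresh that by (simp add: level_insert)
  have sur: "surplus (insert e A) D = surplus A D + bonus (isize e)" for D
    using itA e by (simp add: surplus_insert_item items_def)
  have neq: "insert e B \<noteq> B'" if "B' \<in> Q" for B B'
    using fresh(1)[of B'] that by auto
  consider (few) "C = {}" "Q = {} \<or> (\<exists>X. Q = {X})"
    | (two) X Y where "Q = {X, Y}" "X \<noteq> Y" "level X \<le> level Y" "1 < level X + level Y"
        "0 \<le> surplus A C + 6/5 * level Y \<or>
         (\<exists>f. X = {f} \<and> isize f \<le> 1/2 \<and> bonus (isize f) - 1 \<le> surplus A C)"
    using inv unfolding bbf2_inv_def by blast
  then show ?thesis
  proof cases
    case few
    from step show ?thesis
    proof cases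
      case (pack B)
      then show ?thesis using few by (auto simp: bbf2_inv_def)
    next
      case open_new
      show ?thesis
      proof (cases "Q = {}")
        case True
        then show ?thesis using few open_new by (auto simp: bbf2_inv_def)
      next
        case False
        then obtain X where X: "Q = {X}" using few by auto
        \<comment> \<open>Nothing has been closed yet, so the surplus is a sum of bonuses.\<close>
        have "0 \<le> surplus (insert e A) {}"
          by (simp add: surplus_def sum_nonneg bonus_nonneg)
        then show ?thesis
          using X open_new few epos neq[of X "{}"]
          by (intro bbf2_inv_paid[of _ "{e}" X]) (auto simp: fits_def)
      qed
    next
      case (close_and_open B)
      then show ?thesis using few by auto
    qed
  next
    case two
    have XQ: "X \<in> Q" and YQ: "Y \<in> Q" and cardQ: "card Q = 2" using two by auto
    from step show ?thesis
    proof cases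
      case (pack B)
      show ?thesis
      \<comment> \<open>Packing into the fuller bin preserves either alternative. Packing into
        \<open>X\<close> ends a saving phase.\<close>
      proof (cases "B = Y")
        case True
        have Q': "Q' = {X, insert e Y}" using pack True two(1,2) by auto
        have X: "X \<noteq> insert e Y" using neq[OF XQ] by blast
        have sum: "1 < level X + level (insert e Y)"
          using two(4) epos lev_ins[OF YQ] by linarith
        have sur': "surplus A C \<le> surplus (insert e A) C'"
          using bonus_nonneg[of "isize e"] pack(1) by (simp add: sur)
        show ?thesis
          using two(5)
        proof
          assume "0 \<le> surplus A C + 6/5 * level Y"
          then have "0 \<le> surplus (insert e A) C' + 6/5 * level (insert e Y)"
            using sur' epos lev_ins[OF YQ] by linarith
          then show ?thesis using bbf2_inv_paid[OF Q' X sum] by blast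
        next
          assume "\<exists>f. X = {f} \<and> isize f \<le> 1/2 \<and> bonus (isize f) - 1 \<le> surplus A C"
          then obtain f where f: "X = {f}" "isize f \<le> 1/2" "bonus (isize f) - 1 \<le> surplus A C"
            by auto
          then show ?thesis
            using bbf2_inv_saving[of Q' f "insert e Y"] Q' X sum sur' by simp
        qed
      next
        case False
        then have B: "B = X" using pack two by auto
        have Q': "Q' = {insert e X, Y}" using pack(2) B two(1,2) by auto
        have Y: "insert e X \<noteq> Y" using neq[OF YQ] by blast
        have sum: "1 < level (insert e X) + level Y"
          using two(4) epos lev_ins[OF XQ] by linarith
        have sur': "surplus (insert e A) C' = surplus A C + bonus (isize e)"
          using pack(1) by (simp add: sur)
        show ?thesis
          using two(5)
        proof
          assume "0 \<le> surplus A C + 6/5 * level Y"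
          then have "0 \<le> surplus (insert e A) C' + 6/5 * level Y"
            using sur' bonus_nonneg[of "isize e"] by linarith
          then show ?thesis using bbf2_inv_paid[OF Q' Y sum] by blast
        next
          assume "\<exists>f. X = {f} \<and> isize f \<le> 1/2 \<and> bonus (isize f) - 1 \<le> surplus A C"
          then obtain f where f: "X = {f}" "isize f \<le> 1/2" "bonus (isize f) - 1 \<le> surplus A C"
            by auto
          \<comment> \<open>If \<open>e\<close> fitted into \<open>Y\<close>, the best-fit rule
            would give \<open>level Y \<le> level X \<le> 1/2\<close>, contradicting a total level
            above 1.\<close>
          have "\<not> fits e Y"
            using pack(5) B two(3,4) f YQ by auto
          \<comment> \<open>The maximum appears because either bin may now be the fuller one. It is
            at least \<open>1 - isize e\<close> since \<open>e\<close> does not fit into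
            \<open>Y\<close>, and at least \<open>1 - isize f\<close> since the total level exceeded
            1.\<close>
          then have "1 \<le> 6/5 * max (level Y) (isize f + isize e) + bonus (isize f) + bonus (isize e)"
            using two(4) f(1,2) by (intro bonus_pair_pays) (auto simp: fits_def)
          moreover have "level (insert e X) = isize f + isize e"
            using lev_ins[OF XQ] f(1) by simp
          ultimately have "0 \<le> surplus (insert e A) C' + 6/5 * max (level Y) (level (insert e X))"
            using f(3) sur' by simp
          then show ?thesis
            using bbf2_inv_paid[OF Q' Y sum] by (auto simp: max_def split: if_splits)
        qed
      qed
    next
      case open_new
      then show ?thesis using cardQ by simp
    next
      case (close_and_open B)
      have "B \<notin> C" using close_and_open st by (auto simp: bbf_state_def)
      then have sur': "surplus (insert e A) C' = surplus A C + 6/5 * level B - 1 + bonus (isize e)"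
        using close_and_open fin by (simp add: sur surplus_insert_bin)
      obtain R where R: "Q = {R, B}" "R \<noteq> B"
        using two(1,2) close_and_open(5) by blast
      have "level Y \<le> level B"
        using close_and_open(6) YQ by blast
      \<comment> \<open>In a tie the closed bin may be \<open>X\<close>; the levels still agree with
        those of the case \<open>B = Y\<close>.\<close>
      moreover have XY: "R = X \<and> B = Y \<or> R = Y \<and> B = X"
        using two(1,2) R by (auto simp: doubleton_eq_iff)
      ultimately have lev: "level B = level Y" "level R = level X"
        using two(3) by (auto intro: antisym)
      have Q': "Q' = {{e}, R}" using close_and_open(2) R by blast
      have eR: "{e} \<noteq> R" using neq[of R "{}"] R by auto
      have sum: "1 < isize e + level R"
        using close_and_open(3) R by (auto simp: fits_def)
      have half: "1/2 < level B" using two(3,4) lev(1) by simp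
      show ?thesis
        using two(5)
      proof
        assume paid: "0 \<le> surplus A C + 6/5 * level Y"
        show ?thesis
        \<comment> \<open>After closing \<open>B\<close>, the surplus is at least
          \<open>bonus (isize e) - 1\<close>. For \<open>e\<close> above 1/2, adding
          \<open>6/5 * level {e}\<close> makes this nonnegative; otherwise a saving phase starts
          with \<open>e\<close>.\<close>
        proof (cases "1/2 < isize e")
          case True
          then have "0 \<le> surplus (insert e A) C' + 6/5 * level {e}"
            using paid sur' lev(1) by (simp add: bonus_big)
          then show ?thesis
            using bbf2_inv_paid[OF Q' eR] sum by simp
        next
          case False
          then show ?thesis
            using paid sur' lev(1) bbf2_inv_saving[OF Q' eR sum] by simp
        qed
      next
        assume "\<exists>f. X = {f} \<and> isize f \<le> 1/2 \<and> bonus (isize f) - 1 \<le> surplus A C"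
        then obtain f where f: "X = {f}" "isize f \<le> 1/2" "bonus (isize f) - 1 \<le> surplus A C"
          by auto
        \<comment> \<open>The item does not fit into a bin of level at most 1/2. Since
          \<open>6/5 * 1/2 + 2/5 = 1\<close>, it pays for the closed bin, and \<open>f\<close> stays
          saved beside the new bin \<open>{e}\<close>.\<close>
        have big: "bonus (isize e) = 2/5"
          using sum f(1,2) lev(2) by (intro bonus_big) auto
        have "R = {f}"
          using XY f(1,2) lev(1) half by auto
        then show ?thesis
          using Q' eR sum f(2,3) sur' half big
          by (intro bbf2_inv_saving[of _ f "{e}"]) auto
      qed
    qed
  qed
qed

lemma bbf_run_inv:
  assumes "bbf_run 2 {} {} es C Q" "items (set es)" "distinct es"
  shows "bbf2_inv (set es) C Q"
  using assms
proof (induction rule: bbf_run.induct)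
  case Nil
  then show ?case by (simp add: bbf2_inv_def)
next
  case (snoc es C Q e C' Q')
  have it: "items (set es)" using items_subset[OF snoc.prems(1)] by auto
  have st: "bbf_state 2 (set es) C Q"
    using bbf_run_state[OF snoc.hyps(1) it] snoc.prems by simp
  then show ?case
    using bbf_step_inv[OF snoc.hyps(2) st] snoc.IH it snoc.prems by simp
qed

text \<open>The additive constant covers a deficit of at most 6/5 and the two open bins.\<close>

lemma bbf2_card_le:
  assumes run: "bbf_run 2 {} {} es C Q" and it: "items (set es)" and es: "distinct es"
  shows "real (card (C \<union> Q)) \<le> 1.7 * real (OPT (set es)) + 4"
proof -
  have st: "bbf_state 2 (set es) C Q" using bbf_run_state[OF run it es] .
  note fin = bbf_state_finite[OF st it]
  have part: "partition_on (set es) (C \<union> Q)" "C \<inter> Q = {}" "card Q \<le> 2"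
    and lev1: "\<And>B. B \<in> Q \<Longrightarrow> level B \<le> 1"
    using st by (auto simp: bbf_state_def is_packing_def)
  have "level (set es) = (\<Sum>B\<in>C \<union> Q. level B)"
    using sum_partition_on[of "set es"] part by (simp add: level_def)
  also have "\<dots> = (\<Sum>B\<in>C. level B) + (\<Sum>B\<in>Q. level B)"
    using fin part by (intro sum.union_disjoint) auto
  finally have "level (set es) = (\<Sum>B\<in>C. level B) + (\<Sum>B\<in>Q. level B)" .
  moreover have "(\<Sum>B\<in>Q. level B) \<ge> 0"
  proof (rule sum_nonneg)
    fix B assume "B \<in> Q"
    then have "B \<subseteq> set es" using part by (auto simp: partition_on_def)
    then show "0 \<le> level B" using level_mono[OF items_subset[OF it], of B "{}"] by (simp add: level_def)
  qed
  ultimately have lev: "(\<Sum>B\<in>C. level B) \<le> level (set es)" by simp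
  have empty: "- (6/5) \<le> surplus (set es) {}"
    using sum_nonneg[of "set es" "\<lambda>e. bonus (isize e)"] bonus_nonneg by (simp add: surplus_def)
  \<comment> \<open>The worst case is the paid alternative with \<open>level Y = 1\<close>; a saving
    phase costs at most 1.\<close>
  have "- (6/5) \<le> surplus (set es) C"
    using bbf_run_inv[OF run it es] unfolding bbf2_inv_def
  proof (elim disjE conjE exE, goal_cases)
    case (3 X Y)
    then show ?case using lev1[of Y] by simp
  next
    case (4 X Y f)
    then show ?case using bonus_nonneg[of "isize f"] by simp
  qed (simp_all add: empty)
  then have "real (card C) \<le> 1.7 * real (OPT (set es)) + 6/5"
    using total_weight_le_OPT[OF it] lev by (simp add: surplus_def)
  moreover have "card (C \<union> Q) \<le> card C + 2"
    using card_Un_le[of C Q] part by simp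
  ultimately show ?thesis by simp
qed

section \<open>The number of bins containing a colour\<close>

text \<open>The items \<open>es\<close> fit together in one bin. Once they have opened a bin
  \<open>N\<close>, it contains only items of \<open>es\<close>, so every later one fits into it,
  and no further bin is opened or closed.\<close>

lemma bbf_run_one_bin:
  assumes "bbf_run k C0 Q0 es C Q" "finite C0" "finite Q0"
    and "items (set es)" "distinct es" "level (set es) \<le> 1"
  shows "finite C \<and> finite Q \<and> C0 \<subseteq> C \<and>
    (card C + card Q \<le> card C0 + card Q0 \<or>
     card C + card Q \<le> card C0 + card Q0 + 1 \<and> (\<exists>N\<in>Q. N \<subseteq> set es))"
  using assms
proof (induction rule: bbf_run.induct)
  case Nil
  then show ?case by simp
next
  case (snoc es C Q e C' Q')
  let ?n = "card C0 + card Q0"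
  have it: "items (set es)" using items_subset[OF snoc.prems(3)] by auto
  have lev: "level (set es) + isize e \<le> 1"
    using snoc.prems by (simp add: level_insert)
  have lev': "level (set es) \<le> 1"
    using level_mono[OF snoc.prems(3), of "set es"] snoc.prems(5) by fastforce
  have IH: "finite C" "finite Q" "C0 \<subseteq> C"
    "card C + card Q \<le> ?n \<or> card C + card Q \<le> ?n + 1 \<and> (\<exists>N\<in>Q. N \<subseteq> set es)"
    using snoc.IH snoc.prems it lev' by auto
  have le: "card C + card Q \<le> ?n" if nofit: "\<forall>B\<in>Q. \<not> fits e B"
  proof (rule ccontr)
    assume "\<not> ?thesis"
    then obtain N where N: "N \<in> Q" "N \<subseteq> set es" using IH by auto
    then have "fits e N" using level_mono[OF it N(2)] lev by (simp add: fits_def)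
    with N nofit show False by blast
  qed
  from snoc.hyps(2) show ?case
  proof cases
    case (pack B)
    have c: "card Q' \<le> card Q" using pack card_replace_le[OF IH(2)] by simp
    have "\<exists>N\<in>Q'. N \<subseteq> set (es @ [e])" if ex: "\<exists>N\<in>Q. N \<subseteq> set es"
    proof -
      obtain N where N: "N \<in> Q" "N \<subseteq> set es" using ex by blast
      show ?thesis using N pack by (cases "N = B") auto
    qed
    then show ?thesis using c IH pack by auto
  next
    case open_new
    then have "card Q' \<le> Suc (card Q)" using IH by (simp add: card_insert_if)
    then show ?thesis using IH open_new le by auto
  next
    case (close_and_open B)
    have "card Q' \<le> card Q" using close_and_open card_replace_le[OF IH(2)] by simp
    moreover have "card C' \<le> Suc (card C)" using IH close_and_open by (simp add: card_insert_if)
    ultimately show ?thesis using IH close_and_open le by auto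
  qed
qed

lemma bbf_run_bins:
  assumes "bbf_run k C0 Q0 (concat bs) C Q" "finite C0" "finite Q0"
    and "items (set (concat bs))" "distinct (concat bs)" "\<forall>b\<in>set bs. level (set b) \<le> 1"
  shows "finite C \<and> finite Q \<and> C0 \<subseteq> C \<and> card C + card Q \<le> card C0 + card Q0 + length bs"
  using assms
proof (induction bs arbitrary: C0 Q0)
  case Nil
  then show ?case by simp
next
  case (Cons b bs)
  then obtain C1 Q1 where r1: "bbf_run k C0 Q0 b C1 Q1" and r2: "bbf_run k C1 Q1 (concat bs) C Q"
    by (auto simp: bbf_run_append)
  have it: "items (set b)" "items (set (concat bs))"
    using Cons.prems(4) by (auto intro: items_subset)
  have 1: "finite C1 \<and> finite Q1 \<and> C0 \<subseteq> C1 \<and>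
      (card C1 + card Q1 \<le> card C0 + card Q0 \<or>
       card C1 + card Q1 \<le> card C0 + card Q0 + 1 \<and> (\<exists>N\<in>Q1. N \<subseteq> set b))"
    using Cons.prems it by (intro bbf_run_one_bin[OF r1]) auto
  have "finite C \<and> finite Q \<and> C1 \<subseteq> C \<and> card C + card Q \<le> card C1 + card Q1 + length bs"
    using Cons.prems it 1 by (intro Cons.IH[OF r2]) auto
  with 1 show ?case by auto
qed

section \<open>Changes in the number of bins with a given colour\<close>

lemma bins_with_colour_Un: "bins_with_colour (P \<union> P') c \<le> bins_with_colour P c + bins_with_colour P' c"
proof -
  have "{B \<in> P \<union> P'. \<exists>e\<in>B. colour e = c} =
      {B \<in> P. \<exists>e\<in>B. colour e = c} \<union> {B \<in> P'. \<exists>e\<in>B. colour e = c}"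
    by auto
  then show ?thesis by (simp add: bins_with_colour_def card_Un_le)
qed

lemma bins_with_colour_insert:
  assumes "finite P"
  shows "bins_with_colour (insert D (P - {B})) c \<le>
    (if \<exists>e\<in>D. colour e = c then 1 else 0) + bins_with_colour (P - {B}) c"
proof -
  have "{E \<in> insert D (P - {B}). \<exists>e\<in>E. colour e = c} \<subseteq>
      (if \<exists>e\<in>D. colour e = c then {D} else {}) \<union> {E \<in> P - {B}. \<exists>e\<in>E. colour e = c}"
    by auto
  then show ?thesis
    using assms unfolding bins_with_colour_def
    by (intro order_trans[OF card_mono order_trans[OF card_Un_le]]) auto
qed

lemma bins_with_colour_remove:
  assumes "finite P" "B \<in> P"
  shows "bins_with_colour P c =
    (if \<exists>e\<in>B. colour e = c then 1 else 0) + bins_with_colour (P - {B}) c"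
proof -
  have "{E \<in> P. \<exists>e\<in>E. colour e = c} =
      (if \<exists>e\<in>B. colour e = c then insert B else id) {E \<in> P - {B}. \<exists>e\<in>E. colour e = c}"
    using assms(2) by auto
  then show ?thesis
    using assms(1) unfolding bins_with_colour_def by simp
qed

text \<open>An item of another colour gives no bin the colour \<open>c\<close>, and closing a bin
  only moves its contribution from the second summand to the first.\<close>

lemma bbf_run_other_colours:
  assumes "bbf_run k C0 Q0 es C Q" "finite C0" "finite Q0" "\<forall>e\<in>set es. colour e \<noteq> c"
  shows "finite C \<and> finite Q \<and>
    bins_with_colour C c + bins_with_colour Q c \<le> bins_with_colour C0 c + bins_with_colour Q0 c"
  using assms
proof (induction rule: bbf_run.induct)
  case Nil
  then show ?case by simp
next
  case (snoc es C Q e C' Q')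
  have IH: "finite C" "finite Q" and e: "colour e \<noteq> c"
    and le: "bins_with_colour C c + bins_with_colour Q c \<le> bins_with_colour C0 c + bins_with_colour Q0 c"
    using snoc by auto
  have "finite C' \<and> finite Q' \<and>
    bins_with_colour C' c + bins_with_colour Q' c \<le> bins_with_colour C c + bins_with_colour Q c"
    using snoc.hyps(2)
  proof cases
    case (pack B)
    then show ?thesis
      using IH e bins_with_colour_insert[OF IH(2), of "insert e B" B c]
        bins_with_colour_remove[OF IH(2) pack(3), of c]
      by auto
  next
    case open_new
    \<comment> \<open>Opening is treated as replacing \<open>{e}\<close> by itself.\<close>
    then show ?thesis
      using IH e bins_with_colour_insert[OF IH(2), of "{e}" "{e}" c]
        bins_with_colour_remove[of "insert {e} Q" "{e}" c]
        bins_with_colour_remove[OF IH(2), of "{e}" c]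
      by (cases "{e} \<in> Q") (auto simp: insert_absorb)
  next
    case (close_and_open B)
    then show ?thesis
      using IH e bins_with_colour_insert[OF IH(2), of "{e}" B c]
        bins_with_colour_remove[OF IH(2) close_and_open(5), of c]
        bins_with_colour_remove[of "insert B C" B c]
        bins_with_colour_remove[OF IH(1), of B c]
      by (cases "B \<in> C") (auto simp: insert_absorb)
  qed
  with le show ?case by simp
qed

text \<open>Bins closed before the first item of colour \<open>c\<close> never contain that colour.
  The block \<open>concat bs\<close> adds at most \<open>length bs\<close> bins, and the 2 accounts
  for the bins open when it starts. Later items add no bin with colour \<open>c\<close>.\<close>

lemma bbf2_bins_with_colour_le:
  assumes run: "bbf_run 2 {} {} (es1 @ concat bs @ es2) C Q"
    and it: "items (set (es1 @ concat bs @ es2))" and dist: "distinct (es1 @ concat bs @ es2)"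
    and lev: "\<forall>b\<in>set bs. level (set b) \<le> 1"
    and col: "\<forall>e\<in>set es1 \<union> set es2. colour e \<noteq> c"
  shows "bins_with_colour (C \<union> Q) c \<le> length bs + 2"
proof -
  obtain C1 Q1 C2 Q2 where r1: "bbf_run 2 {} {} es1 C1 Q1"
    and r2: "bbf_run 2 C1 Q1 (concat bs) C2 Q2" and r3: "bbf_run 2 C2 Q2 es2 C Q"
    using run by (auto simp: bbf_run_append)
  have it': "items (set es1)" "items (set (concat bs))"
    using it by (auto intro: items_subset)
  have st: "bbf_state 2 (set es1) C1 Q1"
    using bbf_run_state[OF r1 it'(1)] dist by simp
  note fin = bbf_state_finite[OF st it'(1)]
  have 2: "finite C2 \<and> finite Q2 \<and> C1 \<subseteq> C2 \<and> card C2 + card Q2 \<le> card C1 + card Q1 + length bs"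
    using fin it' dist lev by (intro bbf_run_bins[OF r2]) auto
  have "\<forall>B\<in>C1. \<forall>e\<in>B. colour e \<noteq> c"
    using st col by (force simp: bbf_state_def is_packing_def partition_on_def)
  then have "bins_with_colour C2 c \<le> card (C2 - C1)"
    unfolding bins_with_colour_def using 2 by (intro card_mono) auto
  also have "\<dots> = card C2 - card C1"
    using 2 fin by (simp add: card_Diff_subset)
  finally have "bins_with_colour C2 c \<le> card C2 - card C1" .
  moreover have "bins_with_colour Q2 c \<le> card Q2"
    unfolding bins_with_colour_def using 2 by (intro card_mono) auto
  \<comment> \<open>Makes the truncated subtraction above exact.\<close>
  moreover have "card C1 \<le> card C2"
    using 2 by (intro card_mono) auto
  moreover have "bins_with_colour C c + bins_with_colour Q c \<le>
      bins_with_colour C2 c + bins_with_colour Q2 c"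
    using bbf_run_other_colours[OF r3] 2 col by auto
  moreover have "card Q1 \<le> 2"
    using st by (simp add: bbf_state_def)
  ultimately show ?thesis
    using 2 bins_with_colour_Un[of C Q c] by linarith
qed

section \<open>The algorithm\<close>

lemma ordered_packing:
  assumes "is_ordered_packing L bs"
  shows "set (concat bs) = L" "distinct (concat bs)" "\<forall>b\<in>set bs. level (set b) \<le> 1"
  using assms by (auto simp: is_ordered_packing_def is_packing_def partition_on_def)

lemma computes_approximate_packings_colour_then_bbf:
  assumes A: "flvl_guarantee \<epsilon> A"
  shows "computes_approximate_packings 1.7 (1 + 2 * \<epsilon>) (colour_then_bbf A)"
  unfolding computes_approximate_packings_def
\<comment> \<open>The 4 is dictated by the total number of bins. Each colour contributes only 1 from
  the scheme and 2 from the open bins, independently of \<open>m\<close>.\<close>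
proof (intro exI[of _ 4] allI impI)
  fix m I assume "coloured_instance m I"
  then have I: "items I" "\<And>e. e \<in> I \<Longrightarrow> colour e \<in> {1..m}"
    by (auto simp: coloured_instance_def)
  define F where "F cs = concat (concat (map (\<lambda>c. A (of_colour I c)) cs))" for cs
  have F_Cons: "F (c # cs) = concat (A (of_colour I c)) @ F cs"
    and F_append: "F (cs @ ds) = F cs @ F ds" and F_Nil: "F [] = []" for c cs ds
    by (auto simp: F_def)
  have oc: "items (of_colour I c)" for c
    using items_subset[OF I(1)] by (auto simp: of_colour_def)
  note ord = ordered_packing[OF conjunct1[OF A[unfolded flvl_guarantee_def, rule_format, OF oc]]]
  have len: "real (length (A (of_colour I c))) \<le> (1 + 2 * \<epsilon>) * real (OPT (of_colour I c)) + 1" for c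
    using A oc by (simp add: flvl_guarantee_def)
  have setF: "set (F cs) = {e \<in> I. colour e \<in> set cs}" for cs
  proof (induction cs)
    case (Cons c cs)
    then show ?case unfolding F_Cons set_append ord(1) by (auto simp: of_colour_def)
  qed (simp add: F_Nil)
  have distF: "distinct (F cs)" if "distinct cs" for cs
    using that
  proof (induction cs)
    case (Cons c cs)
    then show ?case
      unfolding F_Cons distinct_append ord(1) using ord(2)[of c]
      by (auto simp: of_colour_def setF)
  qed (simp add: F_Nil)
  have all: "set (F cs) = I" if "set cs = {1..m}" for cs
    using that I(2) by (auto simp: setF)
  have alg: "colour_then_bbf A m I =
      {C \<union> Q | C Q cs. distinct cs \<and> set cs = {1..m} \<and> bbf_run 2 {} {} (F cs) C Q}"
    by (simp add: colour_then_bbf_def bounded_best_fit_iff_run F_def)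
  have ne: "colour_then_bbf A m I \<noteq> {}"
  proof -
    have cs: "distinct [1..<Suc m]" "set [1..<Suc m] = {1..m}" by auto
    have "\<exists>C Q. bbf_run 2 {} {} (F [1..<Suc m]) C Q"
      using bbf_run_exists[of 2 "F [1..<Suc m]"] distF[OF cs(1)] all[OF cs(2)] I(1) by simp
    then show ?thesis using cs unfolding alg by blast
  qed
  have good: "is_packing I P \<and> real (card P) \<le> 1.7 * real (OPT I) + 4 \<and>
      (\<forall>c\<in>{1..m}. real (bins_with_colour P c) \<le> (1 + 2 * \<epsilon>) * real (OPT (of_colour I c)) + 4)"
    if PA: "P \<in> colour_then_bbf A m I" for P
  proof -
    obtain C Q cs where P: "P = C \<union> Q" and cs: "distinct cs" "set cs = {1..m}"
      and run: "bbf_run 2 {} {} (F cs) C Q"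
      using PA unfolding alg by blast
    have it: "items (set (F cs))" using all[OF cs(2)] I by simp
    have "real (bins_with_colour P c) \<le> (1 + 2 * \<epsilon>) * real (OPT (of_colour I c)) + 4"
      if c: "c \<in> {1..m}" for c
    proof -
      obtain cs1 cs2 where split: "cs = cs1 @ c # cs2"
        using split_list[of c cs] c cs by auto
      have F: "F cs = F cs1 @ concat (A (of_colour I c)) @ F cs2"
        by (simp add: split F_append F_Cons)
      have "bins_with_colour P c \<le> length (A (of_colour I c)) + 2"
        unfolding P
      proof (rule bbf2_bins_with_colour_le[of "F cs1" _ "F cs2"])
        show "\<forall>e\<in>set (F cs1) \<union> set (F cs2). colour e \<noteq> c"
          using cs(1) by (auto simp: setF split)
        show "\<forall>b\<in>set (A (of_colour I c)). level (set b) \<le> 1"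
          by (rule ord(3))
      qed (use run it distF[OF cs(1)] in \<open>simp_all only: F\<close>)
      then show ?thesis using len[of c] by linarith
    qed
    moreover have "is_packing I P"
      using bbf_run_state[OF run it distF[OF cs(1)]] all[OF cs(2)] by (simp add: P bbf_state_def)
    moreover have "real (card P) \<le> 1.7 * real (OPT I) + 4"
      using bbf2_card_le[OF run it distF[OF cs(1)]] all[OF cs(2)] by (simp add: P)
    ultimately show ?thesis by blast
  qed
  show "colour_then_bbf A m I \<noteq> {} \<and> (\<forall>P\<in>colour_then_bbf A m I. is_packing I P \<and>
      real (card P) \<le> 1.7 * real (OPT I) + 4 \<and>
      (\<forall>c\<in>{1..m}. real (bins_with_colour P c) \<le> (1 + 2 * \<epsilon>) * real (OPT (of_colour I c)) + 4))"
    using ne good by blast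
qed

text \<open>Parameter \<open>\<epsilon>\<close> of the scheme yields the factor
  \<open>1 + 2 * \<epsilon>\<close> per colour, so the factor \<open>1 + \<epsilon>\<close> is
  reached by running it with \<open>\<epsilon> / 2\<close>.\<close>

theorem theorem3:
  fixes flvl :: "real \<Rightarrow> item set \<Rightarrow> item list list"
  assumes "\<And>\<epsilon>. 0 < \<epsilon> \<Longrightarrow> flvl_guarantee \<epsilon> (flvl \<epsilon>)"
  shows "\<forall>\<epsilon>>0. computes_approximate_packings 1.7 (1 + 2 * \<epsilon>) (colour_then_bbf (flvl \<epsilon>)) \<and>
               computes_approximate_packings 1.7 (1 + \<epsilon>) (colour_then_bbf (flvl (\<epsilon> / 2)))"
proof (intro allI impI conjI)
  fix \<epsilon> :: real assume "0 < \<epsilon>"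
  then show "computes_approximate_packings 1.7 (1 + 2 * \<epsilon>) (colour_then_bbf (flvl \<epsilon>))"
    using assms computes_approximate_packings_colour_then_bbf by blast
  show "computes_approximate_packings 1.7 (1 + \<epsilon>) (colour_then_bbf (flvl (\<epsilon> / 2)))"
    using computes_approximate_packings_colour_then_bbf[OF assms[of "\<epsilon> / 2"]] \<open>0 < \<epsilon>\<close> by simp
qed

end
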